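(* Let $n,d\ge1$ be integers, let $v_1,\dots,v_n\in\mathbb{R}^d$, and let $\Lambda\in\mathbb{R}^{d\times d}$ be a (symmetric) positive definite matrix. For $S\subseteq[n]$ let $f(S)=\mathrm{tr}\big((\Lambda+\sum_{i\in S}v_iv_i^\top)^{-1}\big)$ and $F_{\mathrm{reciprocal}}(S)=1/f(S)$, and let $h_{\max}=\max_{i\in[n]}v_i^\top\Lambda^{-1}v_i$. Then the submodularity ratio of $F_{\mathrm{reciprocal}}$ satisfies $$\gamma(F_{\mathrm{reciprocal}})\ge(1+h_{\max})^{-1}.$$
   Context: Notation: $[n]=\{1,\dots,n\}$. The submodularity ratio of a set function $g:2^{[n]}\to\mathbb{R}$ that is monotone non-decreasing is $$\gamma(g)=\min_{S,L\subseteq[n],\ S\cap L=\emptyset}\frac{\sum_{i\in S}\big(g(L\cup\{i\})-g(L)\big)}{g(L\cup S)-g(L)},$$ where the minimum is over pairs for which the denominator is nonzero (and $\gamma(g)=1$ if there is no such pair). *)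

theory Defs
  imports "HOL-Analysis.Analysis"
begin

definition pos_def :: "real^'d^'d \<Rightarrow> bool" where
  "pos_def A \<longleftrightarrow> transpose A = A \<and> (\<forall>x. x \<noteq> 0 \<longrightarrow> x \<bullet> (A *v x) > 0)"

definition outer_prod :: "real^'d \<Rightarrow> real^'d \<Rightarrow> real^'d^'d" where
  "outer_prod v w = (\<chi> i j. v $ i * w $ j)"

definition f_inv_trace :: "real^'d^'d \<Rightarrow> (nat \<Rightarrow> real^'d) \<Rightarrow> nat set \<Rightarrow> real" where
  "f_inv_trace \<Lambda> v S = trace (matrix_inv (\<Lambda> + (\<Sum>i\<in>S. outer_prod (v i) (v i))))"

definition F_reciprocal :: "real^'d^'d \<Rightarrow> (nat \<Rightarrow> real^'d) \<Rightarrow> nat set \<Rightarrow> real" where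
  "F_reciprocal \<Lambda> v S = 1 / f_inv_trace \<Lambda> v S"

definition h_max :: "real^'d^'d \<Rightarrow> (nat \<Rightarrow> real^'d) \<Rightarrow> nat \<Rightarrow> real" where
  "h_max \<Lambda> v n = (MAX i\<in>{1..n}. v i \<bullet> (matrix_inv \<Lambda> *v v i))"

text \<open>The submodularity ratio is meant for monotone non-decreasing \<open>g\<close>; the same formula
  is used here for every \<open>g\<close>. Only the values of \<open>g\<close> on subsets of \<open>{1..n}\<close> matter.\<close>

definition ratio_pairs :: "nat \<Rightarrow> (nat set \<Rightarrow> real) \<Rightarrow> (nat set \<times> nat set) set" where
  "ratio_pairs n g = {(S, L). S \<subseteq> {1..n} \<and> L \<subseteq> {1..n} \<and> S \<inter> L = {} \<and> g (L \<union> S) - g L \<noteq> 0}"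

definition submod_ratio :: "nat \<Rightarrow> (nat set \<Rightarrow> real) \<Rightarrow> real" where
  "submod_ratio n g =
     (if ratio_pairs n g = {} then 1
      else MIN (S, L)\<in>ratio_pairs n g.
             (\<Sum>i\<in>S. g (L \<union> {i}) - g L) / (g (L \<union> S) - g L))"

end

theory Submission
  imports Defs
begin

text \<open>
  Let \<open>A\<close> be the matrix at \<open>L\<close>, \<open>B = A + (\<Sum>i\<in>S. v\<^sub>i v\<^sub>i\<^sup>T)\<close>, \<open>X = A\<^sup>-\<^sup>1\<close>, \<open>Y = B\<^sup>-\<^sup>1\<close>.
  From \<open>tr ((Y - sX) B (Y - sX)) \<ge> 0\<close> at \<open>s = tr Y / tr X\<close> one gets the Cauchy--Schwarz bound
  \<open>(tr X)\<^sup>2 \<le> tr Y \<cdot> tr (X B X) = tr Y \<cdot> (tr X + (\<Sum>i\<in>S. |X v\<^sub>i|\<^sup>2))\<close>, that is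
  \<open>1 / tr Y - 1 / tr X \<le> (\<Sum>i\<in>S. |X v\<^sub>i|\<^sup>2) / (tr X)\<^sup>2\<close>. By Sherman--Morrison the gain of a single
  \<open>i\<close> is at least \<open>|X v\<^sub>i|\<^sup>2 / ((1 + v\<^sub>i\<^sup>T X v\<^sub>i) (tr X)\<^sup>2)\<close>, and \<open>v\<^sub>i\<^sup>T X v\<^sub>i \<le> h\<^sub>m\<^sub>a\<^sub>x\<close> because inversion
  is antitone in the Loewner order.
\<close>

section \<open>Quadratic forms, traces and inverses of positive definite matrices\<close>

text \<open>Through this form, claims about traces follow from claims about quadratic forms, one
  basis vector at a time.\<close>

lemma trace_eq_sum_axis:
  fixes M :: "real^'d^'d"
  shows "trace M = (\<Sum>k\<in>UNIV. axis k 1 \<bullet> (M *v axis k 1))"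
  by (simp add: trace_def inner_axis' matrix_vector_mult_basis column_def)

lemma sum_axis_inner_squared:
  fixes x :: "real^'d"
  shows "(\<Sum>k\<in>UNIV. (x \<bullet> axis k 1)\<^sup>2) = (norm x)\<^sup>2"
  unfolding power2_norm_eq_inner inner_axis by (simp add: inner_vec_def power2_eq_square)

lemma outer_prod_mult_vec: "outer_prod v w *v x = (w \<bullet> x) *\<^sub>R v"
  by (simp add: vec_eq_iff outer_prod_def matrix_vector_mult_def inner_vec_def sum_distrib_left
      sum_distrib_right mult_ac)

lemma pos_def_inner_commute:
  assumes "pos_def A" shows "x \<bullet> (A *v y) = (A *v x) \<bullet> y"
  using assms by (metis dot_lmul_matrix pos_def_def transpose_matrix_vector)

lemma pos_def_inner_nonneg:
  assumes "pos_def A" shows "0 \<le> x \<bullet> (A *v x)"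
  using assms by (cases "x = 0") (auto simp: pos_def_def less_imp_le)

lemma pos_def_invertible:
  assumes "pos_def A" shows "invertible A"
proof -
  have "x = 0" if "A *v x = 0" for x
    using assms that unfolding pos_def_def by (metis inner_zero_right less_irrefl)
  then show ?thesis
    by (simp add: invertible_left_inverse matrix_left_invertible_ker)
qed

lemma pos_def_inv_cancel:
  assumes "pos_def A"
  shows "A *v (matrix_inv A *v x) = x" "matrix_inv A *v (A *v x) = x"
proof -
  have "A ** matrix_inv A = mat 1 \<and> matrix_inv A ** A = mat 1"
    unfolding matrix_inv_def
    using pos_def_invertible[OF assms] unfolding invertible_def by (rule someI_ex)
  then show "A *v (matrix_inv A *v x) = x" "matrix_inv A *v (A *v x) = x"
    by (simp_all add: matrix_vector_mul_assoc)
qed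

lemma pos_def_inv_inner_commute:
  assumes "pos_def A" shows "x \<bullet> (matrix_inv A *v y) = (matrix_inv A *v x) \<bullet> y"
  using pos_def_inner_commute[OF assms, of "matrix_inv A *v x" "matrix_inv A *v y"]
  by (simp add: pos_def_inv_cancel[OF assms])

lemma pos_def_inv_inner_pos:
  assumes "pos_def A" "x \<noteq> 0" shows "0 < x \<bullet> (matrix_inv A *v x)"
proof -
  have "matrix_inv A *v x \<noteq> 0"
    using pos_def_inv_cancel(1)[OF assms(1), of x] assms(2) by auto
  then have "0 < (matrix_inv A *v x) \<bullet> (A *v (matrix_inv A *v x))"
    using assms(1) by (simp add: pos_def_def)
  then show ?thesis
    by (simp add: pos_def_inv_cancel[OF assms(1)] inner_commute)
qed

lemma trace_inv_pos:
  assumes "pos_def A" shows "0 < trace (matrix_inv A)"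
  unfolding trace_eq_sum_axis
  by (rule sum_pos) (auto intro!: pos_def_inv_inner_pos[OF assms])

text \<open>The proof uses the variational formula \<open>v\<^sup>T A\<^sup>-\<^sup>1 v = max\<^sub>x (2 x\<^sup>T v - x\<^sup>T A x)\<close>.\<close>

lemma inv_inner_antimono:
  assumes A: "pos_def A" and B: "pos_def B" and le: "\<And>x. x \<bullet> (A *v x) \<le> x \<bullet> (B *v x)"
  shows "v \<bullet> (matrix_inv B *v v) \<le> v \<bullet> (matrix_inv A *v v)"
proof -
  define x where "x = matrix_inv B *v v"
  define y where "y = matrix_inv A *v v"
  have Ay: "A *v y = v" and Bx: "B *v x = v"
    by (simp_all add: x_def y_def pos_def_inv_cancel A B)
  \<comment> \<open>The variational inequality for \<open>A\<close>, tested at the point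
    \<open>x\<close> that attains the maximum for \<open>B\<close>.\<close>
  have "0 \<le> (x - y) \<bullet> (A *v (x - y))"
    by (rule pos_def_inner_nonneg[OF A])
  also have "\<dots> = x \<bullet> (A *v x) - 2 * (x \<bullet> v) + v \<bullet> y"
    using pos_def_inner_commute[OF A, of y x]
    by (simp add: matrix_vector_mult_diff_distrib inner_diff_left inner_diff_right Ay inner_commute)
  also have "x \<bullet> (A *v x) \<le> x \<bullet> v"
    using le[of x] by (simp add: Bx)
  finally show ?thesis
    by (simp add: x_def y_def inner_commute)
qed

lemma trace_inv_antimono:
  assumes "pos_def A" "pos_def B" "\<And>x. x \<bullet> (A *v x) \<le> x \<bullet> (B *v x)"
  shows "trace (matrix_inv B) \<le> trace (matrix_inv A)"
  unfolding trace_eq_sum_axis by (intro sum_mono inv_inner_antimono assms)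

section \<open>Rank-one updates and their sums\<close>

text \<open>The rank-one correction lowers each diagonal entry of the inverse by the square of a
  coordinate of \<open>matrix_inv A *v v\<close>, over a common denominator; these squares add up to
  its squared norm.\<close>

lemma sherman_morrison_trace:
  assumes A: "pos_def A" and B: "pos_def (A + outer_prod v v)"
  shows "trace (matrix_inv (A + outer_prod v v)) =
    trace (matrix_inv A) - (norm (matrix_inv A *v v))\<^sup>2 / (1 + v \<bullet> (matrix_inv A *v v))"
proof -
  define X where "X = matrix_inv A"
  define c where "c = 1 + v \<bullet> (X *v v)"
  have AX: "A *v (X *v w) = w" for w
    by (simp add: X_def pos_def_inv_cancel A)
  have sym: "x \<bullet> (X *v w) = (X *v x) \<bullet> w" for x w
    unfolding X_def by (rule pos_def_inv_inner_commute[OF A])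
  have c: "c > 0"
    using pos_def_inv_inner_pos[OF A, of v] by (cases "v = 0") (auto simp: c_def X_def)
  \<comment> \<open>The right-hand side is a guess, verified by applying
    \<open>A + outer_prod v v\<close>: the coefficient left on \<open>v\<close> cancels because
    \<open>?r * c\<close> equals \<open>(X *v v) \<bullet> w\<close>.\<close>
  have *: "matrix_inv (A + outer_prod v v) *v w = X *v w - ((X *v v) \<bullet> w / c) *\<^sub>R (X *v v)" for w
  proof -
    let ?r = "(X *v v) \<bullet> w / c"
    have "(A + outer_prod v v) *v (X *v w - ?r *\<^sub>R (X *v v))
        = w + ((X *v v) \<bullet> w - ?r * c) *\<^sub>R v"
      by (simp add: matrix_vector_mult_add_rdistrib matrix_vector_mult_diff_distrib
          matrix_vector_mult_scaleR AX outer_prod_mult_vec inner_diff_right sym[of v w] c_def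
          algebra_simps add_divide_distrib flip: scaleR_add_left)
    also have "\<dots> = w" using c by simp
    finally show ?thesis
      using pos_def_inv_cancel(2)[OF B] by metis
  qed
  have "trace (matrix_inv (A + outer_prod v v))
      = (\<Sum>k\<in>UNIV. axis k 1 \<bullet> (X *v axis k 1) - ((X *v v) \<bullet> axis k 1)\<^sup>2 / c)"
    unfolding trace_eq_sum_axis *
    by (simp add: inner_diff_right power2_eq_square inner_commute)
  also have "\<dots> = trace X - (norm (X *v v))\<^sup>2 / c"
    by (simp add: sum_subtractf trace_eq_sum_axis flip: sum_axis_inner_squared sum_divide_distrib)
  finally show ?thesis by (simp add: X_def c_def)
qed

lemma sum_outer_prod_mult_vec:
  assumes "finite S"
  shows "(\<Sum>i\<in>S. outer_prod (v i) (v i)) *v x = (\<Sum>i\<in>S. (v i \<bullet> x) *\<^sub>R v i)"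
  using assms
  by (induction S) (simp_all add: matrix_vector_mult_add_rdistrib outer_prod_mult_vec)

text \<open>The outer products contribute only squares, so the update stays positive definite and
  can only grow in the Loewner order.\<close>

lemma inner_add_sum_outer_prod:
  assumes "finite S"
  shows "x \<bullet> ((A + (\<Sum>i\<in>S. outer_prod (v i) (v i))) *v x) =
    x \<bullet> (A *v x) + (\<Sum>i\<in>S. (v i \<bullet> x)\<^sup>2)"
  by (simp add: matrix_vector_mult_add_rdistrib sum_outer_prod_mult_vec[OF assms] inner_add_right
      inner_sum_right power2_eq_square inner_commute)

lemma pos_def_add_sum_outer_prod:
  assumes A: "pos_def A" and S: "finite S"
  shows "pos_def (A + (\<Sum>i\<in>S. outer_prod (v i) (v i)))"
proof -
  have "transpose (\<Sum>i\<in>S. outer_prod (v i) (v i)) = (\<Sum>i\<in>S. outer_prod (v i) (v i))"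
    by (simp add: vec_eq_iff transpose_def outer_prod_def mult.commute)
  then have "transpose (A + (\<Sum>i\<in>S. outer_prod (v i) (v i))) = A + (\<Sum>i\<in>S. outer_prod (v i) (v i))"
    using A by (simp add: pos_def_def vec_eq_iff transpose_def)
  then show ?thesis
    using A unfolding pos_def_def inner_add_sum_outer_prod[OF S]
    by (auto intro!: add_pos_nonneg sum_nonneg)
qed

section \<open>Cauchy-Schwarz bound for the joint update\<close>

lemma trace_inv_cauchy_schwarz:
  assumes A: "pos_def A" and S: "finite S"
    and B: "B = A + (\<Sum>i\<in>S. outer_prod (v i) (v i))"
  shows "(trace (matrix_inv A))\<^sup>2 \<le> trace (matrix_inv B) *
    (trace (matrix_inv A) + (\<Sum>i\<in>S. (norm (matrix_inv A *v v i))\<^sup>2))"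
proof -
  have pB: "pos_def B" unfolding B by (rule pos_def_add_sum_outer_prod[OF A S])
  define X where "X = matrix_inv A"
  define Y where "Y = matrix_inv B"
  define a where "a = (\<Sum>i\<in>S. (norm (X *v v i))\<^sup>2)"
  \<comment> \<open>With this \<open>s\<close> the first two terms of the quadratic below combine to
    \<open>- trace Y\<close>, and the whole becomes a positive multiple of the claimed
    difference.\<close>
  define s where "s = trace Y / trace X"
  have pos: "trace X > 0" "trace Y > 0"
    by (simp_all add: X_def Y_def trace_inv_pos A pB)
  \<comment> \<open>This is the \<open>k\<close>-th diagonal entry of
    \<open>(Y - sX) B (Y - sX)\<close>, expanded with \<open>YBY = Y\<close>, \<open>YBX = X\<close>
    and \<open>XBX = X\<close> plus the contribution of the outer products.\<close>
  have "0 \<le> axis k 1 \<bullet> (Y *v axis k 1) - 2 * s * (axis k 1 \<bullet> (X *v axis k 1))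
      + s\<^sup>2 * (axis k 1 \<bullet> (X *v axis k 1) + (\<Sum>i\<in>S. ((X *v v i) \<bullet> axis k 1)\<^sup>2))" for k :: 'a
  proof -
    define e :: "real^'a" where "e = axis k 1"
    define x where "x = X *v e"
    define y where "y = Y *v e"
    have By: "B *v y = e" and Ax: "A *v x = e"
      by (simp_all add: x_def y_def X_def Y_def pos_def_inv_cancel A pB)
    have vx: "v i \<bullet> x = (X *v v i) \<bullet> e" for i
      unfolding x_def X_def by (rule pos_def_inv_inner_commute[OF A])
    have xBx: "x \<bullet> (B *v x) = e \<bullet> x + (\<Sum>i\<in>S. ((X *v v i) \<bullet> e)\<^sup>2)"
      unfolding B inner_add_sum_outer_prod[OF S] by (simp add: vx Ax inner_commute[of x e])
    have yBx: "y \<bullet> (B *v x) = e \<bullet> x"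
      using pos_def_inner_commute[OF pB, of y x] by (simp add: By)
    have "0 \<le> (y - s *\<^sub>R x) \<bullet> (B *v (y - s *\<^sub>R x))"
      by (rule pos_def_inner_nonneg[OF pB])
    also have "\<dots> = e \<bullet> y - 2 * s * (e \<bullet> x) + s\<^sup>2 * (x \<bullet> (B *v x))"
      by (simp add: matrix_vector_mult_diff_distrib matrix_vector_mult_scaleR inner_diff_left
          inner_diff_right By yBx inner_commute[of _ e] power2_eq_square algebra_simps)
    finally show ?thesis
      unfolding xBx by (simp add: e_def x_def y_def)
  qed
  then have "0 \<le> (\<Sum>k\<in>(UNIV :: 'a set). axis k 1 \<bullet> (Y *v axis k 1) - 2 * s * (axis k 1 \<bullet> (X *v axis k 1))
      + s\<^sup>2 * (axis k 1 \<bullet> (X *v axis k 1) + (\<Sum>i\<in>S. ((X *v v i) \<bullet> axis k 1)\<^sup>2)))"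
    by (intro sum_nonneg)
  also have "\<dots> = trace Y - 2 * s * trace X
      + s\<^sup>2 * (trace X + (\<Sum>k\<in>UNIV. \<Sum>i\<in>S. ((X *v v i) \<bullet> axis k 1)\<^sup>2))"
    by (simp add: sum.distrib sum_subtractf trace_eq_sum_axis flip: sum_distrib_left)
  \<comment> \<open>For fixed \<open>i\<close> the squared coordinates over the basis sum to the
    squared norm.\<close>
  also have "(\<Sum>k\<in>UNIV. \<Sum>i\<in>S. ((X *v v i) \<bullet> axis k 1)\<^sup>2) = a"
    unfolding a_def sum.swap[of _ S] sum_axis_inner_squared ..
  finally have "0 \<le> trace Y - 2 * s * trace X + s\<^sup>2 * (trace X + a)" .
  also have "\<dots> = trace Y / (trace X)\<^sup>2 * (trace Y * (trace X + a) - (trace X)\<^sup>2)"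
    using pos by (simp add: s_def field_simps power2_eq_square)
  finally have "0 \<le> trace Y * (trace X + a) - (trace X)\<^sup>2"
    using pos by (simp only: zero_le_mult_iff) (smt (verit) divide_pos_pos zero_less_power)
  then show ?thesis by (simp add: X_def Y_def a_def)
qed

section \<open>From single gains to the submodularity ratio\<close>

theorem lemma1:
  fixes n :: nat and v :: "nat \<Rightarrow> real^'d" and \<Lambda> :: "real^'d^'d"
  assumes "n \<ge> 1" and "pos_def \<Lambda>"
  shows "submod_ratio n (F_reciprocal \<Lambda> v) \<ge> inverse (1 + h_max \<Lambda> v n)"
proof -
  define F where "F = F_reciprocal \<Lambda> v"
  define h where "h = h_max \<Lambda> v n"
  have h: "v i \<bullet> (matrix_inv \<Lambda> *v v i) \<le> h" if "i \<in> {1..n}" for i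
    unfolding h_def h_max_def using that by (intro Max_ge) auto
  \<comment> \<open>Since \<open>n \<ge> 1\<close>, index 1 is among those maximized over, so
    \<open>h\<close> dominates a nonnegative number and \<open>1 + h\<close> is positive.\<close>
  have "0 \<le> v 1 \<bullet> (matrix_inv \<Lambda> *v v 1)"
    using pos_def_inv_inner_pos[OF assms(2), of "v 1"] by (cases "v 1 = 0") auto
  also have "\<dots> \<le> h" using assms(1) by (intro h) auto
  finally have h0: "0 \<le> h" .
  have ratio: "inverse (1 + h) \<le> (\<Sum>i\<in>S. F (L \<union> {i}) - F L) / (F (L \<union> S) - F L)"
    if SL: "S \<subseteq> {1..n}" "L \<subseteq> {1..n}" "S \<inter> L = {}" "F (L \<union> S) - F L \<noteq> 0" for S L
  proof -
    have fin: "finite S" "finite L" using SL finite_subset by blast+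
    define M where "M = (\<lambda>T. \<Lambda> + (\<Sum>i\<in>T. outer_prod (v i) (v i)))"
    define A where "A = M L"
    define X where "X = matrix_inv A"
    define t where "t = trace X"
    define a where "a = (\<lambda>i. (norm (X *v v i))\<^sup>2)"
    have F: "F T = 1 / trace (matrix_inv (M T))" for T
      by (simp add: F_def F_reciprocal_def f_inv_trace_def M_def)
    have A: "pos_def A"
      unfolding A_def M_def by (rule pos_def_add_sum_outer_prod[OF assms(2) fin(2)])
    have \<Lambda>A: "x \<bullet> (\<Lambda> *v x) \<le> x \<bullet> (A *v x)" for x
      unfolding A_def M_def inner_add_sum_outer_prod[OF fin(2)] by (simp add: sum_nonneg)
    \<comment> \<open>Disjointness of \<open>L\<close> and \<open>S\<close> splits the sum; the
      cases needed are \<open>T = {i}\<close> for a single gain and \<open>T = S\<close> for the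
      joint one.\<close>
    have M_Un: "M (L \<union> T) = A + (\<Sum>i\<in>T. outer_prod (v i) (v i))" if "T \<subseteq> S" for T
    proof -
      have "finite T" "L \<inter> T = {}" using that SL(3) fin finite_subset by blast+
      then show ?thesis using fin by (simp add: A_def M_def sum.union_disjoint add.assoc)
    qed
    have pos: "pos_def (M (L \<union> T))" and le: "trace (matrix_inv (M (L \<union> T))) \<le> t" if "T \<subseteq> S" for T
    proof -
      have T: "finite T" using that fin finite_subset by blast
      show pos: "pos_def (M (L \<union> T))"
        unfolding M_Un[OF that] by (rule pos_def_add_sum_outer_prod[OF A T])
      show "trace (matrix_inv (M (L \<union> T))) \<le> t"
        unfolding t_def X_def
        by (rule trace_inv_antimono[OF A pos])
          (simp add: M_Un[OF that] inner_add_sum_outer_prod[OF T] sum_nonneg)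
    qed
    have t: "t > 0" unfolding t_def X_def by (rule trace_inv_pos[OF A])
    have FL: "F L = 1 / t" by (simp add: F t_def X_def A_def)
    have gain: "a i / (1 + h) / t\<^sup>2 \<le> F (L \<union> {i}) - F L" if i: "i \<in> S" for i
    proof -
      define u where "u = trace (matrix_inv (M (L \<union> {i})))"
      have u: "u > 0" "u \<le> t"
        using pos[of "{i}"] le[of "{i}"] i by (simp_all add: u_def trace_inv_pos)
      have Mi: "M (L \<union> {i}) = A + outer_prod (v i) (v i)"
        using M_Un[of "{i}"] i by simp
      \<comment> \<open>\<open>A\<close> dominates \<open>\<Lambda>\<close>, so the maximum, taken
        at \<open>\<Lambda>\<close>, bounds the Sherman-Morrison denominator for every
        \<open>L\<close>.\<close>
      have "v i \<bullet> (X *v v i) \<le> v i \<bullet> (matrix_inv \<Lambda> *v v i)"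
        unfolding X_def by (rule inv_inner_antimono[OF assms(2) A \<Lambda>A])
      also have "\<dots> \<le> h" using i SL by (intro h) auto
      finally have hi: "v i \<bullet> (X *v v i) \<le> h" .
      have "0 \<le> v i \<bullet> (X *v v i)"
        using pos_def_inv_inner_pos[OF A, of "v i"] by (cases "v i = 0") (auto simp: X_def)
      then have "a i / (1 + h) \<le> a i / (1 + v i \<bullet> (X *v v i))"
        using hi by (intro divide_left_mono) (auto simp: a_def)
      also have "\<dots> = t - u"
        using sherman_morrison_trace[OF A, of "v i"] pos[of "{i}"] i unfolding u_def Mi
        by (simp add: t_def X_def a_def)
      finally have "a i / (1 + h) / t\<^sup>2 \<le> (t - u) / t\<^sup>2"
        by (rule divide_right_mono) simp
      \<comment> \<open>As \<open>u \<le> t\<close>, replacing \<open>t * u\<close> by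
        \<open>t\<^sup>2\<close> only lowers the gain; the denominator is then the same for all
        \<open>i\<close>, which allows summation.\<close>
      also have "\<dots> \<le> (t - u) / (t * u)"
        using u t by (intro divide_left_mono) (auto simp: power2_eq_square)
      also have "\<dots> = F (L \<union> {i}) - F L"
        using u t unfolding FL F[of "L \<union> {i}"] u_def[symmetric] by (simp add: field_simps)
      finally show ?thesis .
    qed
    define u where "u = trace (matrix_inv (M (L \<union> S)))"
    have u: "u > 0" "u \<le> t"
      using pos[of S] le[of S] by (simp_all add: u_def trace_inv_pos)
    have FS: "F (L \<union> S) = 1 / u" by (simp add: F u_def)
    have "t\<^sup>2 \<le> u * (t + sum a S)"
      using trace_inv_cauchy_schwarz[OF A fin(1) M_Un[OF order_refl]]
      by (simp add: t_def u_def X_def a_def)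
    then have "t\<^sup>2 / u - t \<le> sum a S"
      using u by (simp add: field_simps)
    then have "(t\<^sup>2 / u - t) / t\<^sup>2 \<le> sum a S / t\<^sup>2"
      by (rule divide_right_mono) simp
    also have "(t\<^sup>2 / u - t) / t\<^sup>2 = F (L \<union> S) - F L"
      unfolding FL FS using u t by (simp add: field_simps power2_eq_square)
    finally have "F (L \<union> S) - F L \<le> sum a S / t\<^sup>2" .
    then have "inverse (1 + h) * (F (L \<union> S) - F L) \<le> inverse (1 + h) * (sum a S / t\<^sup>2)"
      using h0 by (intro mult_left_mono) auto
    also have "\<dots> = (\<Sum>i\<in>S. a i / (1 + h) / t\<^sup>2)"
      by (simp add: sum_divide_distrib sum_distrib_left field_simps)
    also have "\<dots> \<le> (\<Sum>i\<in>S. F (L \<union> {i}) - F L)"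
      by (intro sum_mono gain)
    finally have "inverse (1 + h) * (F (L \<union> S) - F L) \<le> (\<Sum>i\<in>S. F (L \<union> {i}) - F L)" .
    \<comment> \<open>Monotonicity (\<open>u \<le> t\<close>) turns the nonzero denominator into a
      positive one, so dividing by it preserves the inequality.\<close>
    moreover have "F (L \<union> S) - F L > 0"
      using SL(4) u t unfolding FL FS by (simp add: field_simps)
    ultimately show ?thesis by (simp add: pos_le_divide_eq)
  qed
  have ratio': "inverse (1 + h) \<le> (\<Sum>i\<in>S. F (insert i L) - F L) / (F (L \<union> S) - F L)"
    if "(S, L) \<in> ratio_pairs n F" for S L
    using that ratio[of S L] by (simp add: ratio_pairs_def)
  have "finite (ratio_pairs n F)"
    by (rule finite_subset[of _ "Pow {1..n} \<times> Pow {1..n}"]) (auto simp: ratio_pairs_def)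
  \<comment> \<open>Covers the default value 1 of the ratio when there are no admissible
    pairs.\<close>
  moreover have "inverse (1 + h) \<le> 1"
    using h0 by (simp add: inverse_le_1_iff)
  ultimately have "inverse (1 + h) \<le> submod_ratio n F"
    unfolding submod_ratio_def by (auto simp: Min_ge_iff dest: ratio')
  then show ?thesis by (simp add: h_def F_def)
qed

end
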